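(* Let $G=(V,E)$ be a graph and let $k>0$ be real. Then $$\mathrm{TH}_k(G)=\left\{\operatorname{diag}(Z) : Z\in\mathbb{S}^V,\ A_G\circ Z=0,\ I\circ Z\leq I,\ \begin{pmatrix}k&\operatorname{diag}(Z)^\top\\ \operatorname{diag}(Z)&Z\end{pmatrix}\succeq0\right\}.$$
   Context: Graphs are finite and simple; $A_G$ is the adjacency matrix of $G$. $\mathbb{S}^V$ is the set of real symmetric $V\times V$ matrices, $I$ is the identity, $\circ$ the entrywise product, $\operatorname{diag}(Z)\in\mathbb{R}^V$ the vector of diagonal entries of $Z$, $\succeq0$ means positive semidefinite, and $I\circ Z\le I$ is meant entrywise (i.e. $Z_{ii}\le1$ for all $i\in V$). The theta body $\mathrm{TH}(G)$ is the set of $x\in\mathbb{R}^V$ for which there exists $Y\in\mathbb{S}^V$ with $\operatorname{diag}(Y)=x$, $A_G\circ Y=0$, and $\begin{pmatrix}1&x^\top\\ x&Y\end{pmatrix}\succeq0$. For real $k\ge0$, $\mathrm{TH}_k(G)=k\,\mathrm{TH}(G)\cap[0,1]^V$. *)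

theory Defs
  imports "HOL-Analysis.Analysis"
begin

(* A finite simple graph whose vertex set is the finite type 'v is given by its edge set,
   a set of two-element sets of vertices. *)
definition simple_graph :: "'v::finite set set \<Rightarrow> bool" where
  "simple_graph E \<longleftrightarrow> (\<forall>e\<in>E. card e = 2)"

(* No clause for i = j is needed: {i, i} has one element, so it is never an edge. *)
definition adjacency_matrix :: "'v::finite set set \<Rightarrow> real^'v^'v" where
  "adjacency_matrix E = (\<chi> i j. if {i, j} \<in> E then 1 else 0)"

definition symmetric_matrices :: "(real^'v::finite^'v) set" where
  "symmetric_matrices = {M. transpose M = M}"

(* Multiplication on the type of vectors is componentwise, hence on matrices (vectors of
   rows) it is the entrywise product; the matrix product is written ** instead.
   Likewise the order on matrices is the entrywise one. *)
abbreviation hadamard :: "real^'v::finite^'v \<Rightarrow> real^'v^'v \<Rightarrow> real^'v^'v"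
  (infixl \<open>\<circ>\<^sub>H\<close> 70) where
  "A \<circ>\<^sub>H B \<equiv> A * B"

definition diag :: "real^'v::finite^'v \<Rightarrow> real^'v" where
  "diag M = (\<chi> i. M $ i $ i)"

definition psd :: "real^'v::finite^'v \<Rightarrow> bool" where
  "psd M \<longleftrightarrow> M \<in> symmetric_matrices \<and> (\<forall>v. 0 \<le> v \<bullet> (M *v v))"

(* The block matrix with rows (c, x^T) and (x, Y); the additional index is None. *)
definition bordered :: "real \<Rightarrow> real^'v::finite \<Rightarrow> real^'v^'v \<Rightarrow> real^'v option^'v option" where
  "bordered c x Y = (\<chi> i j.
     case (i, j) of
       (None, None) \<Rightarrow> c
     | (None, Some b) \<Rightarrow> x $ b
     | (Some a, None) \<Rightarrow> x $ a
     | (Some a, Some b) \<Rightarrow> Y $ a $ b)"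

definition theta_body :: "'v::finite set set \<Rightarrow> (real^'v) set" where
  "theta_body E =
     {x. \<exists>Y\<in>symmetric_matrices.
           diag Y = x \<and> adjacency_matrix E \<circ>\<^sub>H Y = 0 \<and> psd (bordered 1 x Y)}"

definition theta_body_k :: "real \<Rightarrow> 'v::finite set set \<Rightarrow> (real^'v) set" where
  "theta_body_k k E = (\<lambda>x. k *\<^sub>R x) ` theta_body E \<inter> {x. \<forall>i. x $ i \<in> {0..1}}"

lemma hadamard_nth: "(A \<circ>\<^sub>H B) $ i $ j = A $ i $ j * B $ i $ j"
  by simp

lemma mat_1_hadamard_le_iff: "mat 1 \<circ>\<^sub>H Z \<le> mat 1 \<longleftrightarrow> (\<forall>i. Z $ i $ i \<le> 1)"
  by (auto simp: less_eq_vec_def mat_def)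

end

theory Submission
  imports Defs
begin

text \<open>
  The two descriptions differ by the change of variable \<open>Z = k Y\<close>. Multiplying a certificate
  for \<open>y \<in> TH(G)\<close> by \<open>k > 0\<close> turns the bordered matrix with corner \<open>1\<close> and border \<open>y\<close> into
  the one with corner \<open>k\<close> and border \<open>k y\<close> (\<open>bordered_scaleR\<close>), and positive
  semidefiniteness is invariant under positive scaling (\<open>psd_scaleR\<close>). The condition
  that \<open>diag Z\<close> lies in the unit cube reduces to its upper bounds, because the diagonal
  of a positive semidefinite matrix is nonnegative (\<open>psd_diagonal_nonneg\<close>).
\<close>

lemma symmetric_matrices_scaleR:
  "Z \<in> symmetric_matrices \<Longrightarrow> c *\<^sub>R Z \<in> symmetric_matrices"
  by (simp add: symmetric_matrices_def vec_eq_iff transpose_def)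

lemma diag_scaleR: "diag (c *\<^sub>R Z) = c *\<^sub>R diag Z"
  by (simp add: diag_def vec_eq_iff)

lemma bordered_scaleR:
  "bordered (c * d) (c *\<^sub>R x) (c *\<^sub>R Y) = c *\<^sub>R bordered d x Y"
  by (simp add: bordered_def vec_eq_iff split: option.splits)

lemma psd_scaleR:
  assumes "0 \<le> c" and "psd M"
  shows "psd (c *\<^sub>R M)"
  using assms
  by (simp add: psd_def symmetric_matrices_scaleR scaleR_matrix_vector_assoc[symmetric])

text \<open>A diagonal entry is the value of the quadratic form at a standard basis vector.\<close>

lemma psd_diagonal_nonneg:
  assumes "psd M"
  shows "0 \<le> M $ i $ i"
proof -
  have "0 \<le> axis i 1 \<bullet> (M *v axis i 1)"
    using assms by (simp add: psd_def)
  then show ?thesis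
    by (simp add: inner_axis' matrix_vector_mult_basis column_def)
qed

lemma psd_bordered_diagonal_nonneg:
  assumes "psd (bordered c x Y)"
  shows "0 \<le> Y $ i $ i"
  using psd_diagonal_nonneg[OF assms, of "Some i"] by (simp add: bordered_def)

text \<open>
  Without the cube constraint, \<open>Y \<mapsto> k Y\<close> is a bijection from the certificates of points of the
  theta body onto those with corner \<open>k\<close>, with inverse \<open>Z \<mapsto> Z / k\<close>: all conditions are homogeneous
  once the corner is scaled too.
\<close>

lemma scaled_theta_body_eq:
  fixes E :: "'v::finite set set" and k :: real
  assumes "k > 0"
  shows "(\<lambda>x. k *\<^sub>R x) ` theta_body E =
    {diag Z | Z. Z \<in> symmetric_matrices \<and> adjacency_matrix E \<circ>\<^sub>H Z = 0 \<and>
       psd (bordered k (diag Z) Z)}" (is "_ = ?R")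
proof (intro equalityI subsetI)
  fix x assume "x \<in> (\<lambda>x. k *\<^sub>R x) ` theta_body E"
  then obtain Y where Y: "Y \<in> symmetric_matrices" "adjacency_matrix E \<circ>\<^sub>H Y = 0"
      "psd (bordered 1 (diag Y) Y)" and x: "x = k *\<^sub>R diag Y"
    by (auto simp: theta_body_def)
  have "psd (bordered k (diag (k *\<^sub>R Y)) (k *\<^sub>R Y))"
    using Y(3) assms bordered_scaleR[of k 1 "diag Y" Y] by (simp add: diag_scaleR psd_scaleR)
  moreover have "adjacency_matrix E \<circ>\<^sub>H (k *\<^sub>R Y) = 0"
    using Y(2) by (simp add: vec_eq_iff)
  moreover have "x = diag (k *\<^sub>R Y)"
    using x by (simp add: diag_scaleR)
  ultimately show "x \<in> ?R"
    using symmetric_matrices_scaleR[OF Y(1), of k] by blast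
next
  fix x assume "x \<in> ?R"
  then obtain Z where Z: "Z \<in> symmetric_matrices" "adjacency_matrix E \<circ>\<^sub>H Z = 0"
      "psd (bordered k (diag Z) Z)" and x: "x = diag Z"
    by auto
  let ?Y = "inverse k *\<^sub>R Z"
  have "psd (bordered 1 (diag ?Y) ?Y)"
    using Z(3) assms bordered_scaleR[of "inverse k" k "diag Z" Z]
    by (simp add: diag_scaleR psd_scaleR)
  moreover have "adjacency_matrix E \<circ>\<^sub>H ?Y = 0"
    using Z(2) by (simp add: vec_eq_iff)
  ultimately have "diag ?Y \<in> theta_body E"
    using symmetric_matrices_scaleR[OF Z(1), of "inverse k"] by (auto simp: theta_body_def)
  moreover have "x = k *\<^sub>R diag ?Y"
    using assms x by (simp add: diag_scaleR)
  ultimately show "x \<in> (\<lambda>x. k *\<^sub>R x) ` theta_body E"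
    by blast
qed

theorem theorem20:
  fixes E :: "'v::finite set set" and k :: real
  assumes "simple_graph E" and "k > 0"
  shows "theta_body_k k E =
    {diag Z | Z :: real^'v^'v.
       Z \<in> symmetric_matrices \<and>
       adjacency_matrix E \<circ>\<^sub>H Z = 0 \<and>
       mat 1 \<circ>\<^sub>H Z \<le> mat 1 \<and>
       psd (bordered k (diag Z) Z)}"
proof -
  have "diag Z \<in> {x. \<forall>i. x $ i \<in> {0..1}} \<longleftrightarrow> mat 1 \<circ>\<^sub>H Z \<le> mat 1"
    if "psd (bordered k (diag Z) Z)" for Z :: "real^'v^'v"
    using psd_bordered_diagonal_nonneg[OF that]
    unfolding mat_1_hadamard_le_iff by (simp add: diag_def)
  then show ?thesis
    unfolding theta_body_k_def scaled_theta_body_eq[OF assms(2)] by blast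
qed

end
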